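(* Hadamard-type fractional calculus with respect to $x$ is precisely tempered fractional calculus with respect to $\log(x)$. That is: let $0<a<b$ be real, let $s\in\mathbb{C}$, and let $f$ be an integrable function on $[a,b]$. Then for every $\mu\in\mathbb{C}$ with $\mathrm{Re}(\mu)>0$, $${}^{H}_{a}I^{\mu,s}_{x}f(x)={}^{T}_{a}I^{\mu,s}_{\log x}f(x),$$ and for every $\mu\in\mathbb{C}$ with $\mathrm{Re}(\mu)\ge 0$, $${}^{HR}_{a}D^{\mu,s}_{x}f(x)={}^{TR}_{a}D^{\mu,s}_{\log x}f(x),\qquad {}^{HC}_{a}D^{\mu,s}_{x}f(x)={}^{TC}_{a}D^{\mu,s}_{\log x}f(x),$$ for $x\in(a,b)$, in each case for functions $f$ for which the expressions are defined.
   Context: Hadamard-type operators on $(a,b)$, $0<a<b$, with parameter $s\in\mathbb{C}$: for $\mathrm{Re}(\mu)>0$, $${}^{H}_{a}I^{\mu,s}_{x}f(x)=\frac{1}{\Gamma(\mu)}\int_a^x\left(\frac{t}{x}\right)^s\left(\log\frac{x}{t}\right)^{\mu-1}\frac{f(t)}{t}\,dt ,$$ and for $\mathrm{Re}(\mu)\ge0$, with $n=\lfloor\mathrm{Re}(\mu)\rfloor+1$ (so $n-1\le\mathrm{Re}(\mu)<n$), $${}^{HR}_{a}D^{\mu,s}_{x}f(x)=x^{-s}\left(x\frac{d}{dx}\right)^n\Big(x^s\,{}^{H}_{a}I^{n-\mu,s}_{x}f(x)\Big),\qquad {}^{HC}_{a}D^{\mu,s}_{x}f={}^{H}_{a}I^{n-\mu,s}_{x}\left[x^{-s}\left(x\frac{d}{dx}\right)^n\big(x^sf(x)\big)\right].$$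 Tempered operators with respect to a monotonic $C^1$ function $g$ with parameter $s$: for $\mathrm{Re}(\mu)>0$, $${}^{T}_{a}I^{\mu,s}_{g(x)}f(x)=\frac{1}{\Gamma(\mu)}\int_a^x\big(g(x)-g(t)\big)^{\mu-1}e^{-s(g(x)-g(t))}f(t)g'(t)\,dt ,$$ and for $\mathrm{Re}(\mu)\ge0$, with $n=\lfloor\mathrm{Re}(\mu)\rfloor+1$ (so $n-1\le\mathrm{Re}(\mu)<n$), $${}^{TR}_{a}D^{\mu,s}_{g(x)}f=\left(\frac{1}{g'(x)}\frac{d}{dx}+s\right)^n\,{}^{T}_{a}I^{n-\mu,s}_{g(x)}f,\qquad {}^{TC}_{a}D^{\mu,s}_{g(x)}f={}^{T}_{a}I^{n-\mu,s}_{g(x)}\left(\frac{1}{g'(x)}\frac{d}{dx}+s\right)^nf .$$ Here $g(x)=\log x$ is the natural logarithm. *)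

theory Defs
  imports "HOL-Analysis.Analysis"
begin

text \<open>
  Integrals are Lebesgue integrals, and powers with complex exponents are principal powers.
  All the operators are partial: an integral may diverge and a derivative may fail to exist,
  in which case the library constants return an unspecified or default value.  Every operator is
  therefore given as a total function together with a predicate (or a set of points) saying
  where the expression is defined.
\<close>

definition frac_order :: "complex \<Rightarrow> nat" where
  "frac_order \<mu> = nat \<lfloor>Re \<mu>\<rfloor> + 1"


definition hadamard_integrand ::
    "complex \<Rightarrow> complex \<Rightarrow> (real \<Rightarrow> complex) \<Rightarrow> real \<Rightarrow> real \<Rightarrow> complex" where
  "hadamard_integrand \<mu> s f x t =
     of_real (t / x) powr s * of_real (ln (x / t)) powr (\<mu> - 1) * (f t / of_real t)"

definition hadamard_int ::
    "real \<Rightarrow> complex \<Rightarrow> complex \<Rightarrow> (real \<Rightarrow> complex) \<Rightarrow> real \<Rightarrow> complex" where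
  "hadamard_int a \<mu> s f x =
     1 / Gamma \<mu> * (LINT t:{a..x}|lebesgue. hadamard_integrand \<mu> s f x t)"

definition hadamard_int_defined ::
    "real \<Rightarrow> complex \<Rightarrow> complex \<Rightarrow> (real \<Rightarrow> complex) \<Rightarrow> real \<Rightarrow> bool" where
  "hadamard_int_defined a \<mu> s f x \<longleftrightarrow>
     a < x \<and> hadamard_integrand \<mu> s f x absolutely_integrable_on {a..x}"

text \<open>
  The operators with respect to \<open>g\<close> are meant for monotonic \<open>C\<^sup>1\<close> functions \<open>g\<close>, such as
  the logarithm on the positive reals; \<open>deriv g\<close> is then the classical derivative.
\<close>

definition tempered_integrand ::
    "complex \<Rightarrow> complex \<Rightarrow> (real \<Rightarrow> real) \<Rightarrow> (real \<Rightarrow> complex) \<Rightarrow> real \<Rightarrow> real \<Rightarrow> complex" where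
  "tempered_integrand \<mu> s g f x t =
     of_real (g x - g t) powr (\<mu> - 1) * exp (- s * of_real (g x - g t)) * f t * of_real (deriv g t)"

definition tempered_int ::
    "real \<Rightarrow> complex \<Rightarrow> complex \<Rightarrow> (real \<Rightarrow> real) \<Rightarrow> (real \<Rightarrow> complex) \<Rightarrow> real \<Rightarrow> complex" where
  "tempered_int a \<mu> s g f x =
     1 / Gamma \<mu> * (LINT t:{a..x}|lebesgue. tempered_integrand \<mu> s g f x t)"

definition tempered_int_defined ::
    "real \<Rightarrow> complex \<Rightarrow> complex \<Rightarrow> (real \<Rightarrow> real) \<Rightarrow> (real \<Rightarrow> complex) \<Rightarrow> real \<Rightarrow> bool" where
  "tempered_int_defined a \<mu> s g f x \<longleftrightarrow>
     a < x \<and> tempered_integrand \<mu> s g f x absolutely_integrable_on {a..x}"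


definition euler_op :: "(real \<Rightarrow> complex) \<Rightarrow> real \<Rightarrow> complex" where
  "euler_op h x = of_real x * vector_derivative h (at x)"

definition tempered_op ::
    "complex \<Rightarrow> (real \<Rightarrow> real) \<Rightarrow> (real \<Rightarrow> complex) \<Rightarrow> real \<Rightarrow> complex" where
  "tempered_op s g h x = 1 / of_real (deriv g x) * vector_derivative h (at x) + s * h x"

text \<open>
  If \<open>h\<close> is meaningful on the set \<open>A\<close>, the following sets consist of the points at which the
  \<open>n\<close>-th iterate of the operator applied to \<open>h\<close> is meaningful: for a derivative to exist at a
  point, the preceding iterate has to be meaningful in a neighbourhood of the point.
\<close>

primrec euler_dom :: "real set \<Rightarrow> (real \<Rightarrow> complex) \<Rightarrow> nat \<Rightarrow> real set" where
  "euler_dom A h 0 = A"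
| "euler_dom A h (Suc n) =
     {x \<in> interior (euler_dom A h n). (euler_op ^^ n) h differentiable (at x)}"

primrec tempered_dom ::
    "complex \<Rightarrow> (real \<Rightarrow> real) \<Rightarrow> real set \<Rightarrow> (real \<Rightarrow> complex) \<Rightarrow> nat \<Rightarrow> real set" where
  "tempered_dom s g A h 0 = A"
| "tempered_dom s g A h (Suc n) =
     {x \<in> interior (tempered_dom s g A h n).
        deriv g x \<noteq> 0 \<and> (tempered_op s g ^^ n) h differentiable (at x)}"


definition hadamard_RL ::
    "real \<Rightarrow> complex \<Rightarrow> complex \<Rightarrow> (real \<Rightarrow> complex) \<Rightarrow> real \<Rightarrow> complex" where
  "hadamard_RL a \<mu> s f x = (let n = frac_order \<mu> in
     of_real x powr (- s) *
     (euler_op ^^ n) (\<lambda>y. of_real y powr s * hadamard_int a (of_nat n - \<mu>) s f y) x)"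

definition hadamard_RL_defined ::
    "real \<Rightarrow> complex \<Rightarrow> complex \<Rightarrow> (real \<Rightarrow> complex) \<Rightarrow> real \<Rightarrow> bool" where
  "hadamard_RL_defined a \<mu> s f x \<longleftrightarrow> (let n = frac_order \<mu> in
     x \<in> euler_dom {y. hadamard_int_defined a (of_nat n - \<mu>) s f y}
           (\<lambda>y. of_real y powr s * hadamard_int a (of_nat n - \<mu>) s f y) n)"

definition tempered_RL ::
    "real \<Rightarrow> complex \<Rightarrow> complex \<Rightarrow> (real \<Rightarrow> real) \<Rightarrow> (real \<Rightarrow> complex) \<Rightarrow> real \<Rightarrow> complex" where
  "tempered_RL a \<mu> s g f x = (let n = frac_order \<mu> in
     (tempered_op s g ^^ n) (tempered_int a (of_nat n - \<mu>) s g f) x)"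

definition tempered_RL_defined ::
    "real \<Rightarrow> complex \<Rightarrow> complex \<Rightarrow> (real \<Rightarrow> real) \<Rightarrow> (real \<Rightarrow> complex) \<Rightarrow> real \<Rightarrow> bool" where
  "tempered_RL_defined a \<mu> s g f x \<longleftrightarrow> (let n = frac_order \<mu> in
     x \<in> tempered_dom s g {y. tempered_int_defined a (of_nat n - \<mu>) s g f y}
           (tempered_int a (of_nat n - \<mu>) s g f) n)"


text \<open>
  In the Caputo-type operators the differentiated function is only integrated, so it need only
  be meaningful almost everywhere on the interval of integration (as for functions whose
  derivative of order \<open>n - 1\<close> is absolutely continuous).
\<close>

definition hadamard_C ::
    "real \<Rightarrow> complex \<Rightarrow> complex \<Rightarrow> (real \<Rightarrow> complex) \<Rightarrow> real \<Rightarrow> complex" where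
  "hadamard_C a \<mu> s f x = (let n = frac_order \<mu> in
     hadamard_int a (of_nat n - \<mu>) s
       (\<lambda>y. of_real y powr (- s) * (euler_op ^^ n) (\<lambda>z. of_real z powr s * f z) y) x)"

definition hadamard_C_defined ::
    "real \<Rightarrow> complex \<Rightarrow> complex \<Rightarrow> (real \<Rightarrow> complex) \<Rightarrow> real \<Rightarrow> bool" where
  "hadamard_C_defined a \<mu> s f x \<longleftrightarrow> (let n = frac_order \<mu> in
     negligible ({a<..<x} - euler_dom {a<..} (\<lambda>z. of_real z powr s * f z) n) \<and>
     hadamard_int_defined a (of_nat n - \<mu>) s
       (\<lambda>y. of_real y powr (- s) * (euler_op ^^ n) (\<lambda>z. of_real z powr s * f z) y) x)"

definition tempered_C ::
    "real \<Rightarrow> complex \<Rightarrow> complex \<Rightarrow> (real \<Rightarrow> real) \<Rightarrow> (real \<Rightarrow> complex) \<Rightarrow> real \<Rightarrow> complex" where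
  "tempered_C a \<mu> s g f x = (let n = frac_order \<mu> in
     tempered_int a (of_nat n - \<mu>) s g ((tempered_op s g ^^ n) f) x)"

definition tempered_C_defined ::
    "real \<Rightarrow> complex \<Rightarrow> complex \<Rightarrow> (real \<Rightarrow> real) \<Rightarrow> (real \<Rightarrow> complex) \<Rightarrow> real \<Rightarrow> bool" where
  "tempered_C_defined a \<mu> s g f x \<longleftrightarrow> (let n = frac_order \<mu> in
     negligible ({a<..<x} - tempered_dom s g {a<..} f n) \<and>
     tempered_int_defined a (of_nat n - \<mu>) s g ((tempered_op s g ^^ n) f) x)"

end

theory Submission
  imports Defs
begin

text \<open>
  Why the two calculi coincide: put \<open>u = ln x\<close>.  Then \<open>(t / x) powr s = exp (- s * (ln x - ln t))\<close>
  and \<open>dt / t = d(ln t)\<close>, so on \<open>{a..x}\<close> with \<open>a > 0\<close> the two integrands are the same function,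
  and the integral operators agree wherever they are evaluated.

  For the derivatives, \<open>x d/dx = (1 / ln' x) d/dx\<close>, and conjugating this operator by
  multiplication with \<open>x powr s\<close> adds the constant \<open>s\<close>:
  \<open>x d/dx (x powr s * h) = x powr s * (x d/dx + s) h\<close>.  Iterating gives
  \<open>(x d/dx)^n (x powr s * h) = x powr s * ((1 / ln' x) d/dx + s)^n h\<close>, which is the comparison for
  both kinds of fractional derivatives.  At a point where a derivative fails to exist,
  the total functions involved take an arbitrary value and this formula breaks down, so the induction
  has to carry along the sets on which the iterates are meaningful
  (\<open>euler_dom_iterates_conjugate\<close>): since \<open>x powr s\<close> is smooth and nonzero, these sets agree,
  and on them the values do.  In the Caputo case the integrated functions thus agree only almost
  everywhere, which the Lebesgue integral does not see.
\<close>

section \<open>The integral operators\<close>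

lemma deriv_ln:
  assumes "0 < (t :: real)"
  shows "deriv ln t = 1 / t"
  using assms by (intro DERIV_imp_deriv) (auto intro!: derivative_eq_intros)

lemma hadamard_integrand_eq_tempered_integrand:
  assumes "0 < t" "0 < x"
  shows "hadamard_integrand \<mu> s f x t = tempered_integrand \<mu> s ln f x t"
proof -
  have pos: "0 < t / x"
    using assms by simp
  then have "complex_of_real (t / x) powr s = exp (s * of_real (ln (t / x)))"
    by (simp only: powr_def Ln_of_real of_real_eq_0_iff less_imp_neq[THEN not_sym] if_False)
  also have "ln (t / x) = ln t - ln x"
    using assms by (simp add: ln_div)
  also have "s * of_real (ln t - ln x) = - s * of_real (ln x - ln t)"
    by (simp add: algebra_simps)
  finally have "complex_of_real (t / x) powr s = exp (- s * of_real (ln x - ln t))" .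
  moreover have "ln (x / t) = ln x - ln t"
    using assms by (simp add: ln_div)
  moreover have "complex_of_real (deriv ln t) = 1 / of_real t"
    by (simp add: deriv_ln[OF assms(1)])
  ultimately show ?thesis
    by (simp add: hadamard_integrand_def tempered_integrand_def del: of_real_divide of_real_diff)
qed

lemma hadamard_int_eq_tempered_int:
  assumes "0 < a"
  shows "hadamard_int a \<mu> s f x = tempered_int a \<mu> s ln f x"
proof -
  have "(LINT t:{a..x}|lebesgue. hadamard_integrand \<mu> s f x t) =
        (LINT t:{a..x}|lebesgue. tempered_integrand \<mu> s ln f x t)"
    using assms
    by (intro set_lebesgue_integral_cong) (auto intro!: hadamard_integrand_eq_tempered_integrand)
  then show ?thesis
    by (simp add: hadamard_int_def tempered_int_def)
qed

lemma hadamard_int_defined_iff_tempered_int_defined: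
  assumes "0 < a"
  shows "hadamard_int_defined a \<mu> s f x \<longleftrightarrow> tempered_int_defined a \<mu> s ln f x"
proof -
  have "hadamard_integrand \<mu> s f x absolutely_integrable_on {a..x} \<longleftrightarrow>
        tempered_integrand \<mu> s ln f x absolutely_integrable_on {a..x}"
    using assms
    by (intro set_integrable_cong) (auto intro!: hadamard_integrand_eq_tempered_integrand)
  then show ?thesis
    by (simp add: hadamard_int_defined_def tempered_int_defined_def)
qed

lemma tempered_int_defined_cong_AE:
  assumes "negligible N" and "\<And>t. t \<in> {a<..<x} - N \<Longrightarrow> f t = f' t"
  shows "tempered_int_defined a \<mu> s g f x \<longleftrightarrow> tempered_int_defined a \<mu> s g f' x"
proof -
  \<comment> \<open>The hypothesis is silent about the end points, so they join the exceptional set.\<close>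
  have neg: "negligible (N \<union> {a, x})"
    using assms(1) by auto
  have "f t = f' t" if "t \<in> {a..x} - (N \<union> {a, x})" for t
    using that assms(2)[of t] by auto
  then have "tempered_integrand \<mu> s g f x t = tempered_integrand \<mu> s g f' x t"
    if "t \<in> {a..x} - (N \<union> {a, x})" for t
    using that by (simp add: tempered_integrand_def)
  then show ?thesis
    unfolding tempered_int_defined_def
    using absolutely_integrable_spike_eq[OF neg] by metis
qed

lemma tempered_int_cong_AE:
  assumes "negligible N" and "\<And>t. t \<in> {a<..<x} - N \<Longrightarrow> f t = f' t"
    and "tempered_int_defined a \<mu> s g f x"
  shows "tempered_int a \<mu> s g f x = tempered_int a \<mu> s g f' x"
proof -
  have "tempered_int_defined a \<mu> s g f' x"
    using tempered_int_defined_cong_AE[where f = f and f' = f', OF assms(1,2)] assms(3) by blast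
  moreover have "integral {a..x} (tempered_integrand \<mu> s g f x) =
      integral {a..x} (tempered_integrand \<mu> s g f' x)"
  proof (rule integral_spike)
    show "negligible (N \<union> {a, x})"
      using assms(1) by auto
    show "tempered_integrand \<mu> s g f' x t = tempered_integrand \<mu> s g f x t"
      if "t \<in> {a..x} - (N \<union> {a, x})" for t
      using that assms(2)[of t] by (auto simp: tempered_integrand_def)
  qed
  ultimately show ?thesis
    using assms(3)
    by (simp add: tempered_int_def tempered_int_defined_def set_lebesgue_integral_eq_integral(2))
qed

section \<open>Conjugating the Euler operator by a power\<close>

text \<open>
  The product rule, in a form that needs the factorization only near the point and can hence be
  applied to iterates.  It also serves with \<open>- s\<close> for \<open>s\<close>, to recover
  \<open>T\<close> from \<open>E\<close>.
\<close>

lemma has_vector_derivative_powr_mult_locally: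
  fixes E T :: "real \<Rightarrow> complex"
  assumes "0 < x" and "open U" "x \<in> U" and E: "\<And>y. y \<in> U \<Longrightarrow> E y = of_real y powr s * T y"
    and T: "(T has_vector_derivative D) (at x)"
  shows "(E has_vector_derivative of_real x powr s * (D + s / of_real x * T x)) (at x)"
proof -
  have "complex_of_real x \<notin> \<real>\<^sub>\<le>\<^sub>0"
    using \<open>0 < x\<close> by simp
  then have "((\<lambda>z. z powr s) has_field_derivative s * of_real x powr (s - 1)) (at (complex_of_real x))"
    by (rule has_field_derivative_powr)
  then have "((\<lambda>y. complex_of_real y powr s) has_vector_derivative s * of_real x powr (s - 1)) (at x)"
    by (rule has_vector_derivative_real_field)
  then have "((\<lambda>y. complex_of_real y powr s) has_vector_derivative s * (of_real x powr s / of_real x)) (at x)"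
    using \<open>0 < x\<close> by (simp add: powr_diff)
  from has_vector_derivative_mult[OF this T]
  have "((\<lambda>y. of_real y powr s * T y) has_vector_derivative
      of_real x powr s * (D + s / of_real x * T x)) (at x)"
    by (simp add: algebra_simps)
  then show ?thesis
    by (rule has_vector_derivative_transform_within_open[OF _ assms(2,3)]) (simp add: E)
qed

text \<open>Differentiability is inherited in both directions because \<open>x powr s\<close> has no zeros.\<close>

lemma differentiable_powr_mult_iff_locally:
  fixes E T :: "real \<Rightarrow> complex"
  assumes "0 < x" and "open U" "x \<in> U" and E: "\<And>y. y \<in> U \<Longrightarrow> E y = of_real y powr s * T y"
  shows "E differentiable (at x) \<longleftrightarrow> T differentiable (at x)"
proof
  assume "T differentiable (at x)"
  then show "E differentiable (at x)"
    using has_vector_derivative_powr_mult_locally[OF assms]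
    by (metis differentiableI_vector vector_derivative_works)
next
  assume "E differentiable (at x)"
  moreover have "T y = of_real y powr (- s) * E y" if "y \<in> U \<inter> {0<..}" for y
    using that E[of y] by (simp add: powr_minus)
  moreover have "open (U \<inter> {0<..})" "x \<in> U \<inter> {0<..}"
    using assms by auto
  ultimately show "T differentiable (at x)"
    using has_vector_derivative_powr_mult_locally[OF \<open>0 < x\<close>, of "U \<inter> {0<..}" T "- s" E]
    by (metis differentiableI_vector vector_derivative_works)
qed

lemma euler_op_powr_mult_locally:
  assumes "0 < x" and "open U" "x \<in> U" and E: "\<And>y. y \<in> U \<Longrightarrow> E y = of_real y powr s * T y"
    and T: "T differentiable (at x)"
  shows "euler_op E x = of_real x powr s * tempered_op s ln T x"
proof -
  have "vector_derivative E (at x) =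
      of_real x powr s * (vector_derivative T (at x) + s / of_real x * T x)"
    using T
    by (intro vector_derivative_at has_vector_derivative_powr_mult_locally[OF assms(1-4)])
      (simp_all add: vector_derivative_works)
  moreover have "complex_of_real x \<noteq> 0"
    using \<open>0 < x\<close> by simp
  ultimately show ?thesis
    by (simp add: euler_op_def tempered_op_def deriv_ln[OF \<open>0 < x\<close>] field_simps)
qed

text \<open>
  The equality of values at stage \<open>n\<close> is available only on the common domain; its
  interior supplies exactly the neighbourhoods that stage \<open>n + 1\<close> needs.
\<close>

lemma euler_dom_iterates_conjugate:
  assumes "A \<subseteq> {0<..}"
  shows "euler_dom A (\<lambda>y. of_real y powr s * h y) n = tempered_dom s ln A h n"
    and "x \<in> tempered_dom s ln A h n \<Longrightarrow>
      (euler_op ^^ n) (\<lambda>y. of_real y powr s * h y) x =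
      of_real x powr s * (tempered_op s ln ^^ n) h x"
    and "tempered_dom s ln A h n \<subseteq> A"
proof (induction n arbitrary: x)
  case 0
  {
    case 1 show ?case by simp
  next
    case 2 show ?case by simp
  next
    case 3 show ?case by simp
  }
next
  case (Suc n)
  let ?H = "\<lambda>y. of_real y powr s * h y"
  let ?U = "interior (tempered_dom s ln A h n)"
  have U: "0 < x" if "x \<in> ?U" for x
    using that interior_subset Suc.IH(3) assms by fastforce
  have conj: "(euler_op ^^ n) ?H y = of_real y powr s * (tempered_op s ln ^^ n) h y"
    if "y \<in> ?U" for y
    using that interior_subset Suc.IH(2) by blast
  have diff: "(euler_op ^^ n) ?H differentiable (at x) \<longleftrightarrow>
      (tempered_op s ln ^^ n) h differentiable (at x)" if "x \<in> ?U" for x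
    using differentiable_powr_mult_iff_locally[OF U[OF that] open_interior that conj] .
  {
    case 1
    have "deriv ln x \<noteq> (0 :: real)" if "x \<in> ?U" for x
      using U[OF that] deriv_ln[OF U[OF that]] by simp
    then show ?case
      using diff by (auto simp: Suc.IH(1))
  next
    case 2
    then have "x \<in> ?U" and "(tempered_op s ln ^^ n) h differentiable (at x)"
      by auto
    then show ?case
      using euler_op_powr_mult_locally[OF U open_interior _ conj] by simp
  next
    case 3
    show ?case
      using interior_subset Suc.IH(3) by fastforce
  }
qed

section \<open>The fractional derivatives\<close>

lemma hadamard_RL_eq_tempered_RL:
  assumes "0 < a"
  shows "hadamard_RL_defined a \<mu> s f x \<longleftrightarrow> tempered_RL_defined a \<mu> s ln f x"
    and "tempered_RL_defined a \<mu> s ln f x \<Longrightarrow> hadamard_RL a \<mu> s f x = tempered_RL a \<mu> s ln f x"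
proof -
  let ?n = "frac_order \<mu>"
  let ?A = "{y. tempered_int_defined a (of_nat ?n - \<mu>) s ln f y}"
  have A: "?A \<subseteq> {0<..}"
    using assms by (auto simp: tempered_int_defined_def)
  show "hadamard_RL_defined a \<mu> s f x \<longleftrightarrow> tempered_RL_defined a \<mu> s ln f x"
    using euler_dom_iterates_conjugate(1)[OF A]
    by (simp add: hadamard_RL_defined_def tempered_RL_defined_def Let_def
        hadamard_int_eq_tempered_int[OF assms]
        hadamard_int_defined_iff_tempered_int_defined[OF assms])
  assume "tempered_RL_defined a \<mu> s ln f x"
  then have x: "x \<in> tempered_dom s ln ?A (tempered_int a (of_nat ?n - \<mu>) s ln f) ?n"
    by (simp add: tempered_RL_defined_def Let_def)
  then have "0 < x"
    using euler_dom_iterates_conjugate(3)[OF A] A by blast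
  then show "hadamard_RL a \<mu> s f x = tempered_RL a \<mu> s ln f x"
    using euler_dom_iterates_conjugate(2)[OF A x]
    by (simp add: hadamard_RL_def tempered_RL_def Let_def hadamard_int_eq_tempered_int[OF assms]
        powr_minus)
qed

lemma hadamard_C_eq_tempered_C:
  assumes "0 < a"
  shows "hadamard_C_defined a \<mu> s f x \<longleftrightarrow> tempered_C_defined a \<mu> s ln f x"
    and "tempered_C_defined a \<mu> s ln f x \<Longrightarrow> hadamard_C a \<mu> s f x = tempered_C a \<mu> s ln f x"
proof -
  let ?n = "frac_order \<mu>"
  let ?N = "{a<..<x} - tempered_dom s ln {a<..} f ?n"
  let ?F = "\<lambda>y. of_real y powr (- s) * (euler_op ^^ ?n) (\<lambda>z. of_real z powr s * f z) y"
  let ?G = "(tempered_op s ln ^^ ?n) f"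
  have A: "{a<..} \<subseteq> {0<..}"
    using assms by auto
  have FG: "?F t = ?G t" if "t \<in> {a<..<x} - ?N" for t
    using that assms euler_dom_iterates_conjugate(2)[OF A, of t] by (simp add: powr_minus)
  show "hadamard_C_defined a \<mu> s f x \<longleftrightarrow> tempered_C_defined a \<mu> s ln f x"
    unfolding hadamard_C_defined_def tempered_C_defined_def Let_def
      euler_dom_iterates_conjugate(1)[OF A] hadamard_int_defined_iff_tempered_int_defined[OF assms]
    using tempered_int_defined_cong_AE[where f = ?F and f' = ?G, OF _ FG] by blast
  assume *: "tempered_C_defined a \<mu> s ln f x"
  then have N: "negligible ?N"
    by (simp add: tempered_C_defined_def Let_def)
  have "tempered_int_defined a (of_nat ?n - \<mu>) s ln ?F x"
    using * tempered_int_defined_cong_AE[where f = ?F and f' = ?G, OF N FG] by (simp add: tempered_C_defined_def Let_def)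
  then show "hadamard_C a \<mu> s f x = tempered_C a \<mu> s ln f x"
    using tempered_int_cong_AE[where f = ?F and f' = ?G, OF N FG]
    by (simp add: hadamard_C_def tempered_C_def Let_def hadamard_int_eq_tempered_int[OF assms])
qed

theorem theorem3p1:
  fixes a b :: real and s :: complex and f :: "real \<Rightarrow> complex"
  assumes "0 < a" and "a < b" and "f absolutely_integrable_on {a..b}"
  shows "(\<forall>\<mu>. 0 < Re \<mu> \<longrightarrow> (\<forall>x\<in>{a<..<b}.
           (hadamard_int_defined a \<mu> s f x \<longleftrightarrow> tempered_int_defined a \<mu> s ln f x) \<and>
           (hadamard_int_defined a \<mu> s f x \<longrightarrow>
              hadamard_int a \<mu> s f x = tempered_int a \<mu> s ln f x))) \<and>
         (\<forall>\<mu>. 0 \<le> Re \<mu> \<longrightarrow> (\<forall>x\<in>{a<..<b}.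
           (hadamard_RL_defined a \<mu> s f x \<longleftrightarrow> tempered_RL_defined a \<mu> s ln f x) \<and>
           (hadamard_RL_defined a \<mu> s f x \<longrightarrow>
              hadamard_RL a \<mu> s f x = tempered_RL a \<mu> s ln f x))) \<and>
         (\<forall>\<mu>. 0 \<le> Re \<mu> \<longrightarrow> (\<forall>x\<in>{a<..<b}.
           (hadamard_C_defined a \<mu> s f x \<longleftrightarrow> tempered_C_defined a \<mu> s ln f x) \<and>
           (hadamard_C_defined a \<mu> s f x \<longrightarrow>
              hadamard_C a \<mu> s f x = tempered_C a \<mu> s ln f x)))"
  using hadamard_int_eq_tempered_int[OF \<open>0 < a\<close>]
    hadamard_int_defined_iff_tempered_int_defined[OF \<open>0 < a\<close>]
    hadamard_RL_eq_tempered_RL[OF \<open>0 < a\<close>] hadamard_C_eq_tempered_C[OF \<open>0 < a\<close>]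
  by simp

end
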